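(* For any fixed positive integer $M$, $$\mathbf{B}^{*}(x)\mathbf{B}^{*}(y)=\mathbf{B}^{*}(y)\mathbf{B}^{*}(x),\qquad \mathbf{C}^{*}(x)\mathbf{C}^{*}(y)=\mathbf{C}^{*}(y)\mathbf{C}^{*}(x).$$
   Context: The charged free bosons $\varphi_i,\varphi^*_i$ ($i\in\mathbb Z$) satisfy $[\varphi_i,\varphi^*_j]=\delta_{i,-j}$, $[\varphi_i,\varphi_j]=[\varphi^*_i,\varphi^*_j]=0$. They act on the Fock space $\mathcal M$ generated by $|0\rangle$ with $\varphi_i|0\rangle=\varphi^*_{i+1}|0\rangle=0$ for $i\ge0$ (and from the right on the dual Fock space generated by $\langle 0|$ with $\langle 0|\varphi_i=\langle0|\varphi^*_{i+1}=0$ for $i<0$). For a fixed positive integer $M$, $$\mathbf B^*(x)=\exp(x\varphi_{-M}\varphi^*_{M-1})\exp(x\varphi_{-M+1}\varphi^*_{M-2})\cdots,\qquad \mathbf C^*(x)=\cdots\exp(x\varphi_{-M+2}\varphi^*_{M-1})\exp(x\varphi_{-M+1}\varphi^*_{M}),$$ i.e. the ordered products of $\exp(x\varphi_{-i}\varphi^*_{i-1})$ ($i\le M$, $i$ decreasing from left to right) and of $\exp(x\varphi_{-i+1}\varphi^*_{i})$ ($i\le M$, $i$ decreasing from right to left). These are viewed as formal power series in $x$ with operator coefficients; on each fixed vector only finitely many terms contribute to each power of $x$. *)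

theory Defs
  imports Complex_Main "HOL-Library.Poly_Mapping" "HOL-Library.Multiset"
begin

section \<open>The Fock space of the charged free bosons\<close>

text \<open>
  A vector space over a field of characteristic zero with operators \<open>phi i\<close> (the bosons
  \<open>\<phi>\<^sub>i\<close>), \<open>phis i\<close> (the bosons \<open>\<phi>\<^sup>*\<^sub>i\<close>) and a vacuum vector \<open>vac\<close>.
  Since the vacuum module of an infinite Weyl algebra in characteristic zero is irreducible,
  a nonzero cyclic module in which the vacuum relations hold is, up to isomorphism, the module
  presented by the generator \<open>vac\<close> and these relations.
\<close>

locale charged_boson_fock = vector_space scale
  for scale :: "'k::field_char_0 \<Rightarrow> 'v::ab_group_add \<Rightarrow> 'v" +
  fixes phi phis :: "int \<Rightarrow> 'v \<Rightarrow> 'v" and vac :: 'v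
  assumes linear_phi: "Vector_Spaces.linear scale scale (phi i)"
    and linear_phis: "Vector_Spaces.linear scale scale (phis i)"
    and comm_phi_phis: "phi i (phis j v) - phis j (phi i v) = (if i = - j then v else 0)"
    and comm_phi_phi: "phi i (phi j v) = phi j (phi i v)"
    and comm_phis_phis: "phis i (phis j v) = phis j (phis i v)"
    and phi_vac: "0 \<le> i \<Longrightarrow> phi i vac = 0"
    and phis_vac: "0 \<le> i \<Longrightarrow> phis (i + 1) vac = 0"
    and vac_nonzero: "vac \<noteq> 0"
    and generated: "\<lbrakk>subspace U; vac \<in> U;
      \<And>i u. u \<in> U \<Longrightarrow> phi i u \<in> U; \<And>i u. u \<in> U \<Longrightarrow> phis i u \<in> U\<rbrakk> \<Longrightarrow> U = UNIV"


section \<open>Formal power series with operator coefficients\<close>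

text \<open>The series \<open>\<Sum>n. F n x\<^sup>n\<close> is represented by its coefficient sequence \<open>F\<close>.\<close>

type_synonym 'v opser = "nat \<Rightarrow> 'v \<Rightarrow> 'v"

definition op_one :: "'v::ab_group_add opser" where
  "op_one = (\<lambda>n v. if n = 0 then v else 0)"

definition op_mult :: "'v::ab_group_add opser \<Rightarrow> 'v opser \<Rightarrow> 'v opser" where
  "op_mult F G = (\<lambda>n v. \<Sum>k\<le>n. F k (G (n - k) v))"

definition op_prod :: "'v::ab_group_add opser list \<Rightarrow> 'v opser" where
  "op_prod Fs = foldr op_mult Fs op_one"

text \<open>The series \<open>exp (x T)\<close>.\<close>

definition op_exp :: "('k::field_char_0 \<Rightarrow> 'v \<Rightarrow> 'v) \<Rightarrow> ('v \<Rightarrow> 'v) \<Rightarrow> 'v opser" where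
  "op_exp scale T = (\<lambda>n v. scale (1 / fact n) ((T ^^ n) v))"

text \<open>
  Limit of a sequence of series: the coefficient of each power, applied to each vector, has to
  become constant. For the two products below this is shown by \<open>Bstar_stable\<close> and
  \<open>Cstar_stable\<close>, so the description operator is never used on an undefined limit.
\<close>

definition op_lim :: "(nat \<Rightarrow> 'v opser) \<Rightarrow> 'v opser" where
  "op_lim P = (\<lambda>n v. THE w. \<forall>\<^sub>F N in sequentially. P N n v = w)"

text \<open>
  Series in two commuting variables: \<open>F m n\<close> is the coefficient of \<open>x\<^sup>m y\<^sup>n\<close>, and
  \<open>in_x F\<close>, \<open>in_y F\<close> are \<open>F(x)\<close>, \<open>F(y)\<close>.
\<close>

type_synonym 'v opser2 = "nat \<Rightarrow> nat \<Rightarrow> 'v \<Rightarrow> 'v"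

definition in_x :: "'v::ab_group_add opser \<Rightarrow> 'v opser2" where
  "in_x F = (\<lambda>m n v. if n = 0 then F m v else 0)"

definition in_y :: "'v::ab_group_add opser \<Rightarrow> 'v opser2" where
  "in_y F = (\<lambda>m n v. if m = 0 then F n v else 0)"

definition op_mult2 :: "'v::ab_group_add opser2 \<Rightarrow> 'v opser2 \<Rightarrow> 'v opser2" where
  "op_mult2 F G = (\<lambda>m n v. \<Sum>i\<le>m. \<Sum>j\<le>n. F i j (G (m - i) (n - j) v))"


section \<open>The operators \<open>B\<^sup>*\<close> and \<open>C\<^sup>*\<close>\<close>

context
  fixes scale :: "'k::field_char_0 \<Rightarrow> 'v::ab_group_add \<Rightarrow> 'v"
    and phi phis :: "int \<Rightarrow> 'v \<Rightarrow> 'v" and M :: int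
begin

text \<open>
  The partial products of \<open>N\<close> factors run over \<open>i = M, M - 1, \<dots>, M - N + 1\<close>; the factor with
  \<open>i = M\<close> is leftmost in \<open>B\<^sup>*\<close> and rightmost in \<open>C\<^sup>*\<close>.
\<close>

definition Bstar_partial :: "nat \<Rightarrow> 'v opser" where
  "Bstar_partial N = op_prod (map (\<lambda>k. let i = M - int k in
     op_exp scale (phi (- i) \<circ> phis (i - 1))) [0..<N])"

definition Cstar_partial :: "nat \<Rightarrow> 'v opser" where
  "Cstar_partial N = op_prod (map (\<lambda>k. let i = M - int k in
     op_exp scale (phi (- i + 1) \<circ> phis i)) (rev [0..<N]))"

definition Bstar :: "'v opser" where "Bstar = op_lim Bstar_partial"

definition Cstar :: "'v opser" where "Cstar = op_lim Cstar_partial"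

end


section \<open>Convergence of the infinite products\<close>

lemma op_lim_eq:
  assumes "\<And>N. N0 \<le> N \<Longrightarrow> P N n v = P N0 n v" and "N0 \<le> N"
  shows "op_lim P n v = P N n v"
proof -
  have ev: "\<forall>\<^sub>F K in sequentially. P K n v = P N0 n v"
    using assms(1) eventually_sequentially by blast
  have "(THE w. \<forall>\<^sub>F K in sequentially. P K n v = w) = P N0 n v"
  proof (rule the_equality)
    show "\<forall>\<^sub>F K in sequentially. P K n v = P N0 n v" by (rule ev)
  next
    fix w assume "\<forall>\<^sub>F K in sequentially. P K n v = w"
    with ev have "\<forall>\<^sub>F K in sequentially. w = P N0 n v"
      by eventually_elim simp
    then show "w = P N0 n v" by simp
  qed
  then show ?thesis unfolding op_lim_def assms(1)[OF assms(2)] .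
qed

context charged_boson_fock
begin

lemma phi_add: "phi i (u + v) = phi i u + phi i v"
  and phi_scale: "phi i (scale c v) = scale c (phi i v)"
  using linear_phi[of i] by (simp_all add: Vector_Spaces.linear_iff)

lemma phi_0: "phi i 0 = 0"
  using phi_scale[of i 0 0] by simp

lemma phis_add: "phis i (u + v) = phis i u + phis i v"
  and phis_scale: "phis i (scale c v) = scale c (phis i v)"
  using linear_phis[of i] by (simp_all add: Vector_Spaces.linear_iff)

lemma phis_0: "phis i 0 = 0"
  using phis_scale[of i 0 0] by simp

lemma phi_phis: "phi i (phis j v) = phis j (phi i v) + (if i = - j then v else 0)"
  using comm_phi_phis[of i j v] by (simp add: diff_eq_eq add.commute)

lemma locally_annihilated: "\<exists>D. \<forall>j\<ge>D. phi j v = 0"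
proof -
  let ?U = "{v. \<exists>D. \<forall>j\<ge>D. phi j v = 0}"
  have "?U = UNIV"
  proof (rule generated)
    show "subspace ?U"
    proof (rule subspaceI)
      fix u v assume "u \<in> ?U" "v \<in> ?U"
      then obtain D E where "\<forall>j\<ge>D. phi j u = 0" "\<forall>j\<ge>E. phi j v = 0" by blast
      then have "\<forall>j\<ge>max D E. phi j (u + v) = 0" by (simp add: phi_add)
      then show "u + v \<in> ?U" by blast
    qed (auto simp: phi_0 phi_scale intro: exI)
    show "vac \<in> ?U" using phi_vac by blast
  next
    fix i u assume "u \<in> ?U"
    then obtain D where D: "\<forall>j\<ge>D. phi j u = 0" by blast
    then have "\<forall>j\<ge>D. phi j (phi i u) = 0" by (metis comm_phi_phi phi_0)
    then show "phi i u \<in> ?U" by blast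
    from D have "\<forall>j\<ge>max D (1 - i). phi j (phis i u) = 0" by (simp add: phi_phis phis_0)
    then show "phis i u \<in> ?U" by blast
  qed
  then show ?thesis by blast
qed

lemma op_exp_trivial:
  assumes "T v = 0" "T 0 = 0" shows "op_exp scale T n v = op_one n v"
proof (cases n)
  case (Suc m)
  have "(T ^^ m) 0 = 0" using assms(2) by (induction m) simp_all
  then show ?thesis using assms(1) by (simp add: Suc op_exp_def op_one_def funpow_swap1 del: funpow.simps) 
      (simp add: funpow_Suc_right del: funpow.simps)
qed (simp add: op_exp_def op_one_def)

lemma op_one_0: "op_one k 0 = 0" by (simp add: op_one_def)

lemma op_prod_snoc_trivial:
  assumes "\<And>k. F k v = op_one k v" "\<And>k. F k 0 = 0"
  shows "op_prod (Fs @ [F]) n v = op_prod Fs n v"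
proof (induction Fs arbitrary: n)
  case Nil
  have "op_mult F op_one n v = (\<Sum>k\<le>n. if k = n then F k v else 0)"
    unfolding op_mult_def by (rule sum.cong) (auto simp: op_one_def assms(2))
  then show ?case by (simp add: op_prod_def assms(1))
qed (simp add: op_prod_def op_mult_def)

lemma Bstar_stable:
  "\<exists>N0. \<forall>N\<ge>N0. \<forall>n. Bstar_partial scale phi phis M N n v = Bstar scale phi phis M n v"
proof -
  obtain D where D: "\<And>j. D \<le> j \<Longrightarrow> phi j v = 0" using locally_annihilated by blast
  define N0 where "N0 = nat (D + M)"
  have step: "Bstar_partial scale phi phis M (Suc N) n v = Bstar_partial scale phi phis M N n v"
    if "N0 \<le> N" for N n
  proof -
    let ?T = "phi (int N - M) \<circ> phis (M - int N - 1)"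
    have "D \<le> int N - M" using that by (simp add: N0_def)
    then have "?T v = 0" by (simp add: phi_phis D phis_0)
    moreover have "?T 0 = 0" by (simp add: phi_0 phis_0)
    ultimately show ?thesis
      by (auto simp: Bstar_partial_def Let_def op_exp_trivial op_one_0 intro!: op_prod_snoc_trivial)
  qed
  have const: "Bstar_partial scale phi phis M N n v = Bstar_partial scale phi phis M N0 n v"
    if "N0 \<le> N" for N n
    using that by (induction N rule: dec_induct) (simp_all add: step)
  have "Bstar scale phi phis M n v = Bstar_partial scale phi phis M N n v" if "N0 \<le> N" for N n
    unfolding Bstar_def using const that by (rule op_lim_eq)
  then show ?thesis by metis
qed

lemma Cstar_stable:
  "\<exists>N0. \<forall>N\<ge>N0. \<forall>n. Cstar_partial scale phi phis M N n v = Cstar scale phi phis M n v"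
proof -
  obtain D where D: "\<And>j. D \<le> j \<Longrightarrow> phi j v = 0" using locally_annihilated by blast
  define W where "W = {w. \<forall>j\<ge>D. phi j w = 0}"
  define T where "T k = phi (int k - M + 1) \<circ> phis (M - int k)" for k
  have W0: "0 \<in> W" by (simp add: W_def phi_0)
  have Wadd: "u + w \<in> W" if "u \<in> W" "w \<in> W" for u w using that by (simp add: W_def phi_add)
  have T_W: "T k w \<in> W" if "w \<in> W" for k w
  proof -
    let ?a = "int k - M + 1"
    have "phi j (T k w) = 0" if "D \<le> j" for j
    proof -
      have "phi j (phi ?a w) = 0"
        using that \<open>w \<in> W\<close> by (simp add: W_def comm_phi_phi[of j ?a w] phi_0)
      moreover have "phi ?a w = 0" if "j = int k - M"
        using \<open>D \<le> j\<close> that \<open>w \<in> W\<close> by (simp add: W_def)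
      moreover have "T k w = phis (M - int k) (phi ?a w)"
        by (simp add: T_def phi_phis)
      ultimately show ?thesis by (simp add: phi_phis phis_0)
    qed
    then show ?thesis by (simp add: W_def)
  qed
  have exp_W: "op_exp scale (T k) n w \<in> W" if "w \<in> W" for k n w
  proof -
    have "(T k ^^ n) w \<in> W" using that by (induction n) (simp_all add: T_W)
    then show ?thesis by (simp add: op_exp_def W_def phi_scale)
  qed
  have partial_Suc: "Cstar_partial scale phi phis M (Suc N) =
      op_mult (op_exp scale (T N)) (Cstar_partial scale phi phis M N)" for N
    by (simp add: Cstar_partial_def op_prod_def T_def Let_def algebra_simps)
  have partial_W: "Cstar_partial scale phi phis M N n v \<in> W" for N n
  proof (induction N arbitrary: n)
    case 0
    then show ?case using D by (simp add: Cstar_partial_def op_prod_def op_one_def W0) (simp add: W_def)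
  next
    case (Suc N)
    have "sum f A \<in> W" if "finite A" "\<And>a. a \<in> A \<Longrightarrow> f a \<in> W" for f and A :: "nat set"
      using that by (induction A rule: finite_induct) (auto simp: W0 Wadd)
    then show ?case by (simp add: partial_Suc op_mult_def exp_W Suc.IH)
  qed
  define N0 where "N0 = nat (D + M)"
  have step: "Cstar_partial scale phi phis M (Suc N) n v = Cstar_partial scale phi phis M N n v"
    if "N0 \<le> N" for N n
  proof -
    have "op_exp scale (T N) k w = op_one k w" if "w \<in> W" for k w
    proof (rule op_exp_trivial)
      have "D \<le> int N - M + 1" using \<open>N0 \<le> N\<close> by (simp add: N0_def)
      then show "T N w = 0" using that by (simp add: T_def W_def phi_phis phis_0)
      show "T N 0 = 0" by (simp add: T_def phi_0 phis_0)
    qed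
    then have "op_mult (op_exp scale (T N)) (Cstar_partial scale phi phis M N) n v =
        (\<Sum>k\<le>n. if k = 0 then Cstar_partial scale phi phis M N (n - k) v else 0)"
      unfolding op_mult_def by (intro sum.cong) (auto simp: partial_W op_one_def)
    then show ?thesis by (simp add: partial_Suc)
  qed
  have const: "Cstar_partial scale phi phis M N n v = Cstar_partial scale phi phis M N0 n v"
    if "N0 \<le> N" for N n
    using that by (induction N rule: dec_induct) (simp_all add: step)
  have "Cstar scale phi phis M n v = Cstar_partial scale phi phis M N n v" if "N0 \<le> N" for N n
    unfolding Cstar_def using const that by (rule op_lim_eq)
  then show ?thesis by metis
qed

end


section \<open>Existence of the Fock space\<close>

text \<open>
  The polynomial model in variables \<open>z\<^sub>i\<close>, \<open>i \<in> \<int>\<close>, with the monomials encoded as multisets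
  of indices: \<open>\<phi>\<^sub>i\<close> is multiplication by \<open>z\<^sub>i\<close> for \<open>i < 0\<close> and \<open>\<partial>/\<partial>z\<^sub>i\<close> for \<open>i \<ge> 0\<close>, while
  \<open>\<phi>\<^sup>*\<^sub>-\<^sub>i\<close> is multiplication by \<open>z\<^sub>i\<close> for \<open>i \<ge> 0\<close> and \<open>- \<partial>/\<partial>z\<^sub>i\<close> for \<open>i < 0\<close>.
\<close>

type_synonym 'k zpoly = "int multiset \<Rightarrow>\<^sub>0 'k"

lift_definition zscale :: "'k::field_char_0 \<Rightarrow> 'k zpoly \<Rightarrow> 'k zpoly" is "\<lambda>c p A. c * p A"
  by (auto elim!: rev_finite_subset)

lift_definition zmult :: "int \<Rightarrow> 'k::field_char_0 zpoly \<Rightarrow> 'k zpoly" is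
  "\<lambda>i p A. if i \<in># A then p (A - {#i#}) else 0"
proof -
  fix i and p :: "int multiset \<Rightarrow> 'k" assume "finite {A. p A \<noteq> 0}"
  then show "finite {A. (if i \<in># A then p (A - {#i#}) else 0) \<noteq> 0}"
    by (rule finite_surj[where f = "add_mset i"]) (auto simp: image_iff intro!: exI[of _ "_ - {#i#}"])
qed

lift_definition zderiv :: "int \<Rightarrow> 'k::field_char_0 zpoly \<Rightarrow> 'k zpoly" is
  "\<lambda>i p A. of_nat (count A i + 1) * p (add_mset i A)"
proof -
  fix i and p :: "int multiset \<Rightarrow> 'k" assume "finite {A. p A \<noteq> 0}"
  then show "finite {A. of_nat (count A i + 1) * p (add_mset i A) \<noteq> 0}"
    by (rule finite_surj[where f = "\<lambda>A. A - {#i#}"]) (auto simp: image_iff intro!: exI[of _ "add_mset i _"])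
qed

definition zphi :: "int \<Rightarrow> 'k::field_char_0 zpoly \<Rightarrow> 'k zpoly" where
  "zphi i p = (if i < 0 then zmult i p else zderiv i p)"

definition zphis :: "int \<Rightarrow> 'k::field_char_0 zpoly \<Rightarrow> 'k zpoly" where
  "zphis i p = (if i \<le> 0 then zmult (- i) p else - zderiv (- i) p)"

lemma zmult_zmult: "zmult i (zmult j p) = zmult j (zmult i p)"
  by (rule poly_mapping_eqI) (auto simp: zmult.rep_eq in_diff_count diff_right_commute add_mset_commute)

lemma zderiv_zderiv: "zderiv i (zderiv j p) = zderiv j (zderiv i p)"
  by (rule poly_mapping_eqI) (auto simp: zderiv.rep_eq add_mset_commute)

lemma zderiv_zmult: "zderiv i (zmult j p) = zmult j (zderiv i p) + (if i = j then p else 0)"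
proof (rule poly_mapping_eqI)
  fix A
  show "Poly_Mapping.lookup (zderiv i (zmult j p)) A = Poly_Mapping.lookup (zmult j (zderiv i p) + (if i = j then p else 0)) A"
  proof (cases "j \<in># A")
    case True
    then obtain B where "A = add_mset j B" by (metis insert_DiffM)
    then show ?thesis
      by (auto simp: zderiv.rep_eq zmult.rep_eq lookup_add algebra_simps add_mset_commute)
  next
    case False
    then show ?thesis by (auto simp: zderiv.rep_eq zmult.rep_eq lookup_add simp flip: not_in_iff)
  qed
qed

lemma zadd: "zmult i (p + q) = zmult i p + zmult i q" "zderiv i (p + q) = zderiv i p + zderiv i q"
    "zscale c (p + q) = zscale c p + zscale c q"
  and zscale: "zmult i (zscale c p) = zscale c (zmult i p)" "zderiv i (zscale c p) = zscale c (zderiv i p)"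
    "zscale (c + d) p = zscale c p + zscale d p" "zscale c (zscale d p) = zscale (c * d) p"
    "zscale 1 p = p"
  and zminus: "zmult i (- p) = - zmult i p" "zderiv i (- p) = - zderiv i p" "zscale c (- p) = - zscale c p"
  by (auto intro!: poly_mapping_eqI simp: zmult.rep_eq zderiv.rep_eq zscale.rep_eq lookup_add algebra_simps)

lemma zpoly_fock:
  "charged_boson_fock zscale zphi zphis (Poly_Mapping.single {#} (1 :: 'k::field_char_0))"
proof -
  interpret vector_space "zscale :: 'k \<Rightarrow> _"
    by unfold_locales (simp_all add: zadd zscale)
  show ?thesis
  proof (rule charged_boson_fock.intro[OF vector_space_axioms], rule charged_boson_fock_axioms.intro)
    fix U :: "'k zpoly set"
    assume U: "subspace U" "Poly_Mapping.single {#} 1 \<in> U"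
      "\<And>i u. u \<in> U \<Longrightarrow> zphi i u \<in> U" "\<And>i u. u \<in> U \<Longrightarrow> zphis i u \<in> U"
    have mult_U: "zmult i u \<in> U" if "u \<in> U" for i u
      using U(3)[OF that, of i] U(4)[OF that, of "- i"] by (auto simp: zphi_def zphis_def split: if_splits)
    have mult_single: "zmult i (Poly_Mapping.single A 1) = Poly_Mapping.single (add_mset i A) (1 :: 'k)" for i A
      by (rule poly_mapping_eqI) (auto simp: zmult.rep_eq lookup_single when_def)
    have single_U: "Poly_Mapping.single A 1 \<in> U" for A
      by (induction A) (use U(2) mult_U in \<open>auto simp flip: mult_single\<close>)
    have scaled_U: "Poly_Mapping.single A c \<in> U" for A c
    proof -
      have "Poly_Mapping.single A c = zscale c (Poly_Mapping.single A 1)"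
        by (rule poly_mapping_eqI) (auto simp: zscale.rep_eq lookup_single when_def)
      then show ?thesis using subspace_scale[OF U(1) single_U] by simp
    qed
    have "p \<in> U" for p
    proof -
      have "p = (\<Sum>A\<in>Poly_Mapping.keys p. Poly_Mapping.single A (Poly_Mapping.lookup p A))"
        by (rule poly_mapping_eqI) (auto simp: lookup_sum lookup_single when_def in_keys_iff)
      also have "\<dots> \<in> U" by (intro subspace_sum U(1) scaled_U)
      finally show ?thesis .
    qed
    then show "U = UNIV" by blast
  next
    fix i
    show "Vector_Spaces.linear zscale zscale (zphi i :: 'k zpoly \<Rightarrow> _)"
      "Vector_Spaces.linear zscale zscale (zphis i :: 'k zpoly \<Rightarrow> _)"
      by (auto simp: Vector_Spaces.linear_iff zphi_def zphis_def zadd zscale zminus vector_space_axioms)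
  next
    fix i :: int assume "0 \<le> i"
    then show "zphi i (Poly_Mapping.single {#} (1 :: 'k)) = 0"
      "zphis (i + 1) (Poly_Mapping.single {#} (1 :: 'k)) = 0"
      by (auto intro!: poly_mapping_eqI simp: zphi_def zphis_def zderiv.rep_eq lookup_single when_def simp del: single_one)
  next
    show "Poly_Mapping.single {#} (1 :: 'k) \<noteq> 0" by (metis lookup_single_eq lookup_zero zero_neq_one)
  qed (auto simp: zphi_def zphis_def zminus zderiv_zmult zmult_zmult zderiv_zderiv)
qed

end

theory Submission
  imports Defs "HOL-Computational_Algebra.Formal_Power_Series"
begin

text \<open>
  The infinite products commute because their finite partial products already do. On a given
  vector the partial products are eventually constant, so a commutation relation between
  coefficients passes to the limit (\<open>stable_limit_commute\<close>).

  For the partial products the only input is the commutation relations of the exponents. The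
  operators \<open>E\<^sub>a\<^sub>b = \<phi>\<^sub>-\<^sub>a \<phi>\<^sup>*\<^sub>b\<close> satisfy, up to a sign, the commutation relations
  of matrix units, and consecutive factors are exponentials of adjacent off-diagonal
  units. So their exponents \<open>E\<^sub>0, E\<^sub>1, \<dots>\<close> satisfy the Serre relations of a nilpotent
  algebra of type A: \<open>E\<^sub>k\<close> and \<open>E\<^sub>l\<close> commute for \<open>\<bar>k - l\<bar> \<ge> 2\<close>, and
  \<open>H = [E\<^sub>k\<^sub>+\<^sub>1, E\<^sub>k]\<close> commutes with both \<open>E\<^sub>k\<close> and \<open>E\<^sub>k\<^sub>+\<^sub>1\<close>.

  Let \<open>P\<^sub>N(x) = exp (x E\<^sub>0) \<cdots> exp (x E\<^sub>N\<^sub>-\<^sub>1)\<close>. Moving \<open>exp (x E\<^sub>N)\<close> to the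
  right through \<open>P\<^sub>N(y)\<close>, it commutes with every factor except the last, for which the
  Heisenberg relation (\<open>exps_Heisenberg_xy\<close>)
  \<open>exp (x E\<^sub>N) exp (y E\<^sub>N\<^sub>-\<^sub>1) = exp (y E\<^sub>N\<^sub>-\<^sub>1) exp (x E\<^sub>N) exp (x y H)\<close> holds. Hence
  \<open>P\<^sub>N\<^sub>+\<^sub>1(x) P\<^sub>N\<^sub>+\<^sub>1(y) = P\<^sub>N(x) P\<^sub>N(y) exp (x E\<^sub>N) exp (x y H) exp (y E\<^sub>N)\<close>. The
  last three factors commute, so the part to the right of \<open>P\<^sub>N(x) P\<^sub>N(y)\<close> is symmetric in \<open>x\<close>
  and \<open>y\<close>, and induction on \<open>N\<close> gives commutativity (\<open>desc_commute\<close>). This covers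
  \<open>B\<^sup>*\<close>; in \<open>C\<^sup>*\<close> the factors come in the opposite order and the mirror image of the
  argument applies (\<open>asc_commute\<close>).
\<close>

unbundle fps_syntax

section \<open>Exponential series in noncommutative rings\<close>

text \<open>
  A ring in which \<open>n!\<close> is invertible for every \<open>n\<close>: what exponential series need. The
  inverses are automatically central, because \<open>n!\<close> is.
\<close>

locale invertible_factorials =
  fixes invfact :: "nat \<Rightarrow> 'a::ring_1"
  assumes fact_invfact: "of_nat (fact n) * invfact n = 1"
begin

lemma invfact_fact: "invfact n * of_nat (fact n) = 1"
  by (metis fact_invfact mult_of_nat_commute)

lemma invfact_central: "x * invfact n = invfact n * x"
proof -
  have "x * invfact n = invfact n * (of_nat (fact n) * x) * invfact n"
    by (simp add: invfact_fact flip: mult.assoc)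
  also have "\<dots> = invfact n * x * (of_nat (fact n) * invfact n)"
    by (simp only: mult_of_nat_commute mult.assoc)
  finally show ?thesis by (simp add: fact_invfact)
qed

lemma invfact_Suc: "of_nat (Suc n) * invfact (Suc n) = invfact n"
proof -
  have "invfact n * (of_nat (fact n) * (of_nat (Suc n) * invfact (Suc n))) = invfact n"
    using fact_invfact[of "Suc n"]
    by (simp only: fact_Suc of_nat_mult of_nat_id mult_of_nat_commute[of "Suc n" "of_nat (fact n)"] mult.assoc) simp
  then show ?thesis by (simp only: mult.assoc[symmetric] invfact_fact) simp
qed

lemma of_nat_Suc_cancel:
  fixes x y :: 'a
  assumes "of_nat (Suc n) * x = of_nat (Suc n) * y"
  shows "x = y"
proof -
  have "of_nat (fact (Suc n)) * x = of_nat (fact (Suc n)) * y"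
    using arg_cong[OF assms, of "(*) (of_nat (fact n))"]
    by (simp only: fact_Suc of_nat_mult of_nat_id mult_of_nat_commute[of "Suc n" "of_nat (fact n)"] mult.assoc)
  then have "invfact (Suc n) * of_nat (fact (Suc n)) * x = invfact (Suc n) * of_nat (fact (Suc n)) * y"
    by (simp only: mult.assoc)
  then show ?thesis by (simp only: invfact_fact mult_1)
qed

definition exps :: "'a \<Rightarrow> 'a fps" where
  "exps A = Abs_fps (\<lambda>n. invfact n * A ^ n)"

lemma exps_0: "exps A $ 0 = 1"
  using fact_invfact[of 0] by (simp add: exps_def)

lemma exps_Suc: "of_nat (Suc n) * exps A $ Suc n = A * exps A $ n"
proof -
  have "of_nat (Suc n) * exps A $ Suc n = of_nat (Suc n) * invfact (Suc n) * (A * A ^ n)"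
    by (simp only: exps_def fps_nth_Abs_fps power_Suc mult.assoc)
  also have "\<dots> = A * (invfact n * A ^ n)"
    by (simp only: invfact_Suc) (simp flip: mult.assoc add: invfact_central)
  finally show ?thesis by (simp add: exps_def)
qed

lemma exps_commute1:
  assumes "A * B = B * A"
  shows "A * exps B $ n = exps B $ n * A"
proof -
  have "A * (invfact n * B ^ n) = invfact n * (A * B ^ n)"
    by (simp add: invfact_central flip: mult.assoc)
  also have "A * B ^ n = B ^ n * A"
    by (simp add: assms power_commuting_commutes)
  finally show ?thesis by (simp add: exps_def mult.assoc)
qed

lemma exps_commute:
  assumes "A * B = B * A"
  shows "exps A $ m * exps B $ n = exps B $ n * exps A $ m"
proof -
  have "exps B $ n * A = A * exps B $ n"
    using exps_commute1[OF assms] by simp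
  then have "exps B $ n * exps A $ m = exps A $ m * exps B $ n"
    by (rule exps_commute1)
  then show ?thesis by simp
qed

end


section \<open>Series in two commuting variables\<close>

text \<open>
  Series in commuting variables \<open>x\<close> and \<open>y\<close> are series in \<open>x\<close> whose coefficients are series in
  \<open>y\<close>; so \<open>A $ m $ n\<close> belongs to \<open>x\<^sup>m y\<^sup>n\<close>. The three embeddings substitute \<open>x\<close>, \<open>y\<close> and
  \<open>x y\<close> for the variable of a one-variable series, and \<open>swap\<close> exchanges \<open>x\<close> and \<open>y\<close>.
\<close>

definition xser :: "'a::ring_1 fps \<Rightarrow> 'a fps fps" where
  "xser F = Abs_fps (\<lambda>m. fps_const (F $ m))"

definition yser :: "'a::ring_1 fps \<Rightarrow> 'a fps fps" where
  "yser F = fps_const F"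

definition xyser :: "'a::ring_1 fps \<Rightarrow> 'a fps fps" where
  "xyser F = Abs_fps (\<lambda>m. fps_const (F $ m) * fps_X ^ m)"

definition swap :: "'a::ring_1 fps fps \<Rightarrow> 'a fps fps" where
  "swap A = Abs_fps (\<lambda>m. Abs_fps (\<lambda>n. A $ n $ m))"

lemma fps2_ext: "(\<And>m n. A $ m $ n = B $ m $ n) \<Longrightarrow> A = (B :: 'a::zero fps fps)"
  by (intro fps_ext)

lemma xyser_nth: "xyser F $ m $ n = (if m = n then F $ m else 0)"
  by (auto simp: xyser_def fps_X_power_mult_right_nth)

lemma xser_mult_yser_nth: "(xser F * yser G) $ m $ n = F $ m * G $ n"
  by (simp add: xser_def yser_def)

lemma yser_mult_xser_nth: "(yser G * xser F) $ m $ n = G $ n * F $ m"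
  by (simp add: xser_def yser_def)

lemma xser_mult: "xser (F * G) = xser F * xser G"
  by (rule fps2_ext) (simp add: xser_def fps_mult_nth fps_sum_nth sum_distrib_left)

lemma yser_mult: "yser (F * G) = yser F * yser G"
  by (simp add: yser_def)

lemma swap_mult: "swap (A * B) = swap A * swap B"
proof (rule fps2_ext)
  fix m n
  show "swap (A * B) $ m $ n = (swap A * swap B) $ m $ n"
    by (simp add: swap_def fps_mult_nth fps_sum_nth) (rule sum.swap)
qed

lemma swap_xser: "swap (xser F) = yser F"
  by (rule fps2_ext) (simp add: swap_def xser_def yser_def)

lemma swap_yser: "swap (yser F) = xser F"
  by (rule fps2_ext) (simp add: swap_def xser_def yser_def)

lemma swap_xyser: "swap (xyser F) = xyser F"
  by (rule fps2_ext) (simp add: swap_def xyser_nth)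

lemma xser_yser_commute:
  assumes "\<And>m n. F $ m * G $ n = G $ n * F $ m"
  shows "xser F * yser G = yser G * xser F"
  by (rule fps2_ext) (simp add: xser_mult_yser_nth yser_mult_xser_nth assms)

lemma xser_xyser_commute:
  assumes "\<And>m n. F $ m * G $ n = G $ n * F $ m"
  shows "xser F * xyser G = xyser G * xser F"
proof (rule fps_ext)
  fix n
  have "(xser F * xyser G) $ n = (\<Sum>i=0..n. xyser G $ (n - i) * xser F $ i)"
    unfolding fps_mult_nth
    by (intro sum.cong refl fps_ext) (auto simp: xser_def xyser_nth assms)
  also have "\<dots> = (xyser G * xser F) $ n"
    unfolding fps_mult_nth by (rule sum.reindex_bij_witness[of _ "\<lambda>i. n - i" "\<lambda>i. n - i"]) auto
  finally show "(xser F * xyser G) $ n = (xyser G * xser F) $ n" .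
qed

lemma yser_xyser_commute:
  assumes "\<And>m n. F $ m * G $ n = G $ n * F $ m"
  shows "yser F * xyser G = xyser G * yser F"
  using arg_cong[OF xser_xyser_commute[OF assms], of swap]
  by (simp only: swap_mult swap_xser swap_xyser)

lemma commute_prod_list:
  fixes a :: "'b::monoid_mult"
  assumes "\<And>b. b \<in> set bs \<Longrightarrow> a * b = b * a"
  shows "a * prod_list bs = prod_list bs * a"
  using assms
proof (induction bs)
  case (Cons b bs)
  have "a * prod_list (b # bs) = b * (a * prod_list bs)"
    using Cons.prems[of b] by (simp flip: mult.assoc)
  also have "\<dots> = prod_list (b # bs) * a"
    using Cons by (simp add: mult.assoc)
  finally show ?case .
qed simp

lemma xser_1: "xser 1 = 1" and yser_1: "yser 1 = 1"
  by (rule fps2_ext; simp add: xser_def yser_def)+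

lemma xser_prod_list: "xser (prod_list Fs) = prod_list (map xser Fs)"
  and yser_prod_list: "yser (prod_list Fs) = prod_list (map yser Fs)"
  by (induction Fs) (simp_all add: xser_1 yser_1 xser_mult yser_mult)


section \<open>Exponentials of a Heisenberg pair\<close>

context invertible_factorials
begin

text \<open>
  This is \<open>exp (x E) exp (y F) = exp (y F) exp (x E) exp (x y H)\<close>. As \<open>H = [E, F]\<close> commutes with
  \<open>F\<close>, one has \<open>E exp (y F) = exp (y F) (E + y H)\<close>: conjugation by \<open>exp (y F)\<close> turns \<open>E\<close> into
  \<open>E + y H\<close>, hence \<open>exp (x E)\<close> into \<open>exp (x (E + y H))\<close>. The last series splits as
  \<open>exp (x E) exp (x y H)\<close> because \<open>E\<close> and \<open>H\<close> commute. In the proof \<open>K\<close> stands for \<open>E + y H\<close>, and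
  \<open>G m\<close>, the coefficient of \<open>x\<^sup>m\<close> in the split form, equals \<open>K\<^sup>m / m!\<close> by the recursion
  \<open>K G\<^sub>m = (m + 1) G\<^sub>m\<^sub>+\<^sub>1\<close>.
\<close>

lemma exps_Heisenberg_xy:
  assumes H: "H = E * F - F * E" and EH: "E * H = H * E" and FH: "F * H = H * F"
  shows "xser (exps E) * yser (exps F) = yser (exps F) * xser (exps E) * xyser (exps H)"
proof -
  let ?e = "exps E" and ?f = "exps F" and ?h = "exps H"
  define K where "K = fps_const E + fps_const H * fps_X"
  define G where "G m = (xser ?e * xyser ?h) $ m" for m
  have G_nth: "G m $ k = (if k \<le> m then ?e $ (m - k) * ?h $ k else 0)" for m k
  proof -
    have "G m = (\<Sum>i=0..m. fps_const (?e $ i) * xyser ?h $ (m - i))"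
      by (simp add: G_def fps_mult_nth xser_def)
    then have "G m $ k = (\<Sum>i=0..m. ?e $ i * xyser ?h $ (m - i) $ k)"
      by (simp add: fps_sum_nth)
    also have "\<dots> = (\<Sum>i\<in>{0..m}. if k \<le> m \<and> i = m - k then ?e $ i * ?h $ k else 0)"
      by (rule sum.cong) (auto simp: xyser_nth)
    finally show ?thesis by auto
  qed
  have EF: "E * F = F * E + H" by (simp add: H)
  have Ef: "E * ?f $ n = ?f $ n * E + (if n = 0 then 0 else ?f $ (n - 1) * H)" for n
  proof (induction n)
    case 0
    show ?case by (simp add: exps_0)
  next
    case (Suc n)
    have lower: "F * (if n = 0 then 0 else ?f $ (n - 1) * H) = of_nat n * ?f $ n * H"
      by (cases n) (simp_all add: exps_Suc mult.assoc[symmetric] del: of_nat_Suc)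
    have "of_nat (Suc n) * (E * ?f $ Suc n) = E * (of_nat (Suc n) * ?f $ Suc n)"
      by (simp only: mult_of_nat_commute mult.assoc)
    also have "\<dots> = (E * F) * ?f $ n" by (simp only: exps_Suc mult.assoc)
    also have "\<dots> = F * (E * ?f $ n) + H * ?f $ n"
      by (simp add: EF distrib_right mult.assoc)
    also have "\<dots> = F * (?f $ n * E) + F * (if n = 0 then 0 else ?f $ (n - 1) * H) + ?f $ n * H"
      using FH by (simp only: Suc.IH distrib_left exps_commute1[OF FH[symmetric]])
    also have "\<dots> = (of_nat (Suc n) * ?f $ Suc n) * E + of_nat (Suc n) * (?f $ n * H)"
      by (simp only: lower exps_Suc) (simp add: algebra_simps)
    also have "\<dots> = of_nat (Suc n) * (?f $ Suc n * E + ?f $ n * H)"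
      by (simp only: distrib_left mult.assoc)
    finally show ?case using of_nat_Suc_cancel by fastforce
  qed
  have EfK: "fps_const E * ?f = ?f * K"
  proof (rule fps_ext)
    fix n
    have "(?f * (fps_const H * fps_X)) $ n = (if n = 0 then 0 else ?f $ (n - 1) * H)"
      by (simp flip: mult.assoc)
    then show "(fps_const E * ?f) $ n = (?f * K) $ n"
      by (simp add: K_def distrib_left Ef)
  qed
  have KG: "K * G m = of_nat (Suc m) * G (Suc m)" for m
  proof (rule fps_ext)
    fix k
    have KGk: "(K * G m) $ k = E * G m $ k + (if k = 0 then 0 else H * G m $ (k - 1))"
    proof -
      have "(fps_const H * fps_X * G m) $ k = (if k = 0 then 0 else H * G m $ (k - 1))"
        by (simp add: mult.assoc)
      then show ?thesis by (simp add: K_def distrib_right)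
    qed
    have R: "(of_nat (Suc m) * G (Suc m)) $ k = of_nat (Suc m) * G (Suc m) $ k"
      by (metis fps_of_nat fps_mult_left_const_nth)
    \<comment> \<open>The factor \<open>m + 1\<close> splits as \<open>(m + 1 - k) + k\<close>: multiplication by \<open>E\<close> produces the
      first part, multiplication by \<open>y H\<close> the second.\<close>
    have A: "E * G m $ k = of_nat (Suc m - k) * G (Suc m) $ k" if "k \<le> Suc m"
    proof (cases "k = Suc m")
      case False
      then have "E * G m $ k = E * ?e $ (m - k) * ?h $ k"
        using that by (simp add: G_nth mult.assoc)
      also have "\<dots> = of_nat (Suc (m - k)) * ?e $ Suc (m - k) * ?h $ k"
        by (simp only: exps_Suc)
      finally show ?thesis using False that by (simp add: G_nth Suc_diff_le mult.assoc)
    qed (simp add: G_nth)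
    have B: "(if k = 0 then 0 else H * G m $ (k - 1)) = of_nat k * G (Suc m) $ k" if "k \<le> Suc m"
    proof (cases k)
      case (Suc j)
      have "H * G m $ j = ?e $ (m - j) * (H * ?h $ j)"
        using that Suc exps_commute1[OF EH[symmetric], of "m - j"]
        by (simp add: G_nth flip: mult.assoc)
      also have "\<dots> = ?e $ (m - j) * (of_nat (Suc j) * ?h $ Suc j)"
        by (simp only: exps_Suc)
      also have "\<dots> = of_nat (Suc j) * (?e $ (m - j) * ?h $ Suc j)"
        by (simp only: mult_of_nat_commute[of "Suc j"] mult.assoc)
      finally show ?thesis using Suc that by (simp add: G_nth)
    qed simp
    show "(K * G m) $ k = (of_nat (Suc m) * G (Suc m)) $ k"
    proof (cases "k \<le> Suc m")
      case True
      have "(K * G m) $ k = (of_nat (Suc m - k) + of_nat k) * G (Suc m) $ k"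
        by (simp only: KGk A[OF True] B[OF True] distrib_right)
      also have "of_nat (Suc m - k) + of_nat k = (of_nat (Suc m) :: 'a)"
        using True by (simp only: of_nat_add[symmetric]) simp
      finally show ?thesis by (simp only: R)
    next
      case False
      then have "k \<noteq> 0" and "\<not> k - 1 \<le> m" by auto
      with False show ?thesis unfolding KGk R by (simp add: G_nth)
    qed
  qed
  have main: "fps_const (?e $ m) * ?f = ?f * G m" for m
  proof (induction m)
    case 0
    have "G 0 = 1" by (rule fps_ext) (simp add: G_nth exps_0)
    then show ?case by (simp add: exps_0)
  next
    case (Suc m)
    have "of_nat (Suc m) * (fps_const (?e $ Suc m) * ?f) = fps_const (of_nat (Suc m) * ?e $ Suc m) * ?f"
      by (simp only: fps_of_nat[symmetric] fps_const_mult[symmetric] mult.assoc)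
    also have "\<dots> = fps_const E * (fps_const (?e $ m) * ?f)"
      by (simp only: exps_Suc fps_const_mult[symmetric] mult.assoc)
    also have "\<dots> = fps_const E * ?f * G m" by (simp only: Suc.IH mult.assoc)
    also have "\<dots> = ?f * (of_nat (Suc m) * G (Suc m))" by (simp only: EfK KG mult.assoc)
    also have "\<dots> = of_nat (Suc m) * (?f * G (Suc m))"
      by (simp only: mult_of_nat_commute mult.assoc)
    finally have eq: "of_nat (Suc m) * (fps_const (?e $ Suc m) * ?f) = of_nat (Suc m) * (?f * G (Suc m))" .
    show ?case
    proof (rule fps_ext)
      fix n
      have "of_nat (Suc m) * (fps_const (?e $ Suc m) * ?f) $ n = of_nat (Suc m) * (?f * G (Suc m)) $ n"
        using arg_cong[OF eq, of "\<lambda>A. A $ n"]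
        by (simp only: fps_of_nat[symmetric] fps_mult_left_const_nth)
      then show "(fps_const (?e $ Suc m) * ?f) $ n = (?f * G (Suc m)) $ n"
        by (rule of_nat_Suc_cancel)
    qed
  qed
  show ?thesis
  proof (rule fps_ext)
    fix m
    have "(xser ?e * yser ?f) $ m = fps_const (?e $ m) * ?f"
      by (simp add: xser_def yser_def)
    moreover have "(yser ?f * xser ?e * xyser ?h) $ m = ?f * G m"
      by (simp add: mult.assoc yser_def G_def)
    ultimately show "(xser ?e * yser ?f) $ m = (yser ?f * xser ?e * xyser ?h) $ m"
      by (simp add: main)
  qed
qed

lemma exps_Heisenberg_yx:
  assumes "H = E * F - F * E" and "E * H = H * E" and "F * H = H * F"
  shows "yser (exps E) * xser (exps F) = xser (exps F) * yser (exps E) * xyser (exps H)"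
  using arg_cong[OF exps_Heisenberg_xy[OF assms], of swap]
  by (simp only: swap_mult swap_xser swap_yser swap_xyser)

end


section \<open>Ordered products of exponentials along a chain\<close>

text \<open>
  The induction step for descending products, in an arbitrary monoid. Think of \<open>px fx ex\<close> as
  \<open>P(x) exp (x F) exp (x E)\<close>, of \<open>py fy ey\<close> likewise in \<open>y\<close>, and of \<open>h\<close> as \<open>exp (x y H)\<close>. The point
  is that both relations \<open>near\<close> have the same \<open>h\<close>, since \<open>x y\<close> is symmetric; so the product
  equals \<open>(px fx) (py fy) (ex h ey)\<close>, and each of the two groups may exchange \<open>x\<close> and \<open>y\<close>.
\<close>

lemma descending_step:
  fixes px :: "'a::monoid_mult"
  assumes IH: "(px * fx) * (py * fy) = (py * fy) * (px * fx)"
    and far: "ex * py = py * ex" "ey * px = px * ey"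
    and near: "ex * fy = fy * ex * h" "ey * fx = fx * ey * h"
    and e: "ex * ey = ey * ex" "ex * h = h * ex" "ey * h = h * ey"
  shows "(px * fx * ex) * (py * fy * ey) = (py * fy * ey) * (px * fx * ex)"
proof -
  have "(px * fx * ex) * (py * fy * ey) = px * fx * (ex * py) * fy * ey"
    by (simp only: mult.assoc)
  also have "\<dots> = px * fx * py * (ex * fy) * ey" by (simp only: far mult.assoc)
  also have "\<dots> = (px * fx) * (py * fy) * (ex * h * ey)" by (simp only: near mult.assoc)
  also have "\<dots> = (py * fy) * (px * fx) * (ex * h * ey)" by (simp only: IH)
  also have "ex * h * ey = ey * h * ex" by (metis e mult.assoc)
  also have "(py * fy) * (px * fx) * (ey * h * ex) = (py * fy) * px * (fx * ey * h) * ex"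
    by (simp only: mult.assoc)
  also have "fx * ey * h = ey * fx" by (simp only: near)
  also have "(py * fy) * px * (ey * fx) * ex = (py * fy) * (px * ey) * fx * ex"
    by (simp only: mult.assoc)
  also have "px * ey = ey * px" by (simp only: far)
  also have "(py * fy) * (ey * px) * fx * ex = (py * fy * ey) * (px * fx * ex)"
    by (simp only: mult.assoc)
  finally show ?thesis .
qed

text \<open>
  The mirror image of \<open>descending_step\<close>. Here \<open>h\<close> has to end up to the left of \<open>fx\<close> and \<open>fy\<close>, so it
  has to commute with them as well.
\<close>

lemma ascending_step:
  fixes px :: "'a::monoid_mult"
  assumes IH: "(fx * px) * (fy * py) = (fy * py) * (fx * px)"
    and far: "px * ey = ey * px" "py * ex = ex * py"
    and near: "fx * ey = ey * fx * h" "fy * ex = ex * fy * h"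
    and e: "ex * ey = ey * ex" "ex * h = h * ex" "ey * h = h * ey"
    and f: "fx * h = h * fx" "fy * h = h * fy"
  shows "(ex * (fx * px)) * (ey * (fy * py)) = (ey * (fy * py)) * (ex * (fx * px))"
proof -
  have near': "fx * ey = h * ey * fx" "fy * ex = h * ex * fy"
    by (metis near e f mult.assoc)+
  have "(ex * (fx * px)) * (ey * (fy * py)) = ex * fx * (px * ey) * (fy * py)"
    by (simp only: mult.assoc)
  also have "\<dots> = ex * (fx * ey) * px * (fy * py)" by (simp only: far mult.assoc)
  also have "\<dots> = (ex * h * ey) * ((fx * px) * (fy * py))" by (simp only: near' mult.assoc)
  also have "\<dots> = (ex * h * ey) * ((fy * py) * (fx * px))" by (simp only: IH)
  also have "ex * h * ey = ey * h * ex" by (metis e mult.assoc)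
  also have "(ey * h * ex) * ((fy * py) * (fx * px)) = ey * (h * ex * fy) * py * (fx * px)"
    by (simp only: mult.assoc)
  also have "h * ex * fy = fy * ex" by (simp only: near')
  also have "ey * (fy * ex) * py * (fx * px) = ey * fy * (ex * py) * (fx * px)"
    by (simp only: mult.assoc)
  also have "ex * py = py * ex" by (simp only: far)
  also have "ey * fy * (py * ex) * (fx * px) = (ey * (fy * py)) * (ex * (fx * px))"
    by (simp only: mult.assoc)
  finally show ?thesis .
qed

context invertible_factorials
begin

definition desc :: "(nat \<Rightarrow> 'a) \<Rightarrow> nat \<Rightarrow> 'a fps" where
  "desc E N = prod_list (map (\<lambda>k. exps (E k)) [0..<N])"

definition asc :: "(nat \<Rightarrow> 'a) \<Rightarrow> nat \<Rightarrow> 'a fps" where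
  "asc E N = prod_list (map (\<lambda>k. exps (E k)) (rev [0..<N]))"

lemma desc_Suc: "desc E (Suc N) = desc E N * exps (E N)"
  by (simp add: desc_def)

lemma asc_Suc: "asc E (Suc N) = exps (E N) * asc E N"
  by (simp add: asc_def)

text \<open>
  The hypotheses are the Serre relations of type A, the cubic ones being
  \<open>[E\<^sub>k, [E\<^sub>k\<^sub>+\<^sub>1, E\<^sub>k]] = 0\<close> and \<open>[E\<^sub>k\<^sub>+\<^sub>1, [E\<^sub>k\<^sub>+\<^sub>1, E\<^sub>k]] = 0\<close>.
\<close>

context
  fixes E :: "nat \<Rightarrow> 'a"
  assumes far: "\<And>k l. Suc k < l \<Longrightarrow> E l * E k = E k * E l"
    and serre1: "\<And>k. E k * (E (Suc k) * E k - E k * E (Suc k)) = (E (Suc k) * E k - E k * E (Suc k)) * E k"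
    and serre2: "\<And>k. E (Suc k) * (E (Suc k) * E k - E k * E (Suc k)) =
      (E (Suc k) * E k - E k * E (Suc k)) * E (Suc k)"
begin

lemma xser_far_commute:
  assumes "\<forall>k\<in>set ks. Suc k < l"
  shows "xser (exps (E l)) * yser (prod_list (map (\<lambda>k. exps (E k)) ks)) =
    yser (prod_list (map (\<lambda>k. exps (E k)) ks)) * xser (exps (E l))"
  unfolding yser_prod_list
  by (rule commute_prod_list) (use assms in \<open>auto intro!: xser_yser_commute exps_commute far\<close>)

lemma yser_far_commute:
  assumes "\<forall>k\<in>set ks. Suc k < l"
  shows "yser (exps (E l)) * xser (prod_list (map (\<lambda>k. exps (E k)) ks)) =
    xser (prod_list (map (\<lambda>k. exps (E k)) ks)) * yser (exps (E l))"
  using arg_cong[OF xser_far_commute[OF assms], of swap]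
  by (simp only: swap_mult swap_xser swap_yser)

lemma desc_commute_xy: "xser (desc E N) * yser (desc E N) = yser (desc E N) * xser (desc E N)"
proof (induction N rule: less_induct)
  case (less N)
  consider "N = 0" | "N = 1" | n where "N = Suc (Suc n)"
    by (metis One_nat_def not0_implies_Suc)
  then show ?case
  proof cases
    case 1
    then show ?thesis by (simp add: desc_def xser_1 yser_1)
  next
    case 2
    then show ?thesis by (simp add: desc_def) (intro xser_yser_commute exps_commute refl)
  next
    case (3 n)
    let ?H = "E (Suc n) * E n - E n * E (Suc n)"
    note IH = less.IH[of "Suc n", unfolded desc_Suc xser_mult yser_mult]
    note s1 = serre1[of n] and s2 = serre2[of n]
    show ?thesis
      unfolding 3 desc_Suc xser_mult yser_mult
    proof (rule descending_step[where h = "xyser (exps ?H)"])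
      show "xser (exps (E (Suc n))) * yser (desc E n) = yser (desc E n) * xser (exps (E (Suc n)))"
        unfolding desc_def by (rule xser_far_commute) simp
      show "yser (exps (E (Suc n))) * xser (desc E n) = xser (desc E n) * yser (exps (E (Suc n)))"
        unfolding desc_def by (rule yser_far_commute) simp
    qed (use IH 3 in \<open>auto intro!: exps_Heisenberg_xy exps_Heisenberg_yx s1 s2 xser_yser_commute
        xser_xyser_commute yser_xyser_commute exps_commute\<close>)
  qed
qed

text \<open>
  The factor that is moved is now \<open>exp (x E\<^sub>k)\<close> past \<open>exp (y E\<^sub>k\<^sub>+\<^sub>1)\<close>, so the commutator appears
  with the opposite sign.
\<close>

lemma asc_commute_xy: "xser (asc E N) * yser (asc E N) = yser (asc E N) * xser (asc E N)"
proof (induction N rule: less_induct)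
  case (less N)
  consider "N = 0" | "N = 1" | n where "N = Suc (Suc n)"
    by (metis One_nat_def not0_implies_Suc)
  then show ?case
  proof cases
    case 1
    then show ?thesis by (simp add: asc_def xser_1 yser_1)
  next
    case 2
    then show ?thesis by (simp add: asc_def) (intro xser_yser_commute exps_commute refl)
  next
    case (3 n)
    let ?H = "E n * E (Suc n) - E (Suc n) * E n"
    have H: "?H = - (E (Suc n) * E n - E n * E (Suc n))" by simp
    have s1: "E n * ?H = ?H * E n" and s2: "E (Suc n) * ?H = ?H * E (Suc n)"
      unfolding H using serre1[of n] serre2[of n] by (simp_all only: mult_minus_left mult_minus_right)
    note IH = less.IH[of "Suc n", unfolded asc_Suc xser_mult yser_mult]
    show ?thesis
      unfolding 3 asc_Suc xser_mult yser_mult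
    proof (rule ascending_step[where h = "xyser (exps ?H)"])
      show "xser (asc E n) * yser (exps (E (Suc n))) = yser (exps (E (Suc n))) * xser (asc E n)"
        unfolding asc_def by (rule yser_far_commute[symmetric]) simp
      show "yser (asc E n) * xser (exps (E (Suc n))) = xser (exps (E (Suc n))) * yser (asc E n)"
        unfolding asc_def by (rule xser_far_commute[symmetric]) simp
    qed (use IH 3 in \<open>auto intro!: exps_Heisenberg_xy exps_Heisenberg_yx s1 s2 xser_yser_commute
        xser_xyser_commute yser_xyser_commute exps_commute\<close>)
  qed
qed

lemma desc_commute: "desc E N $ m * desc E N $ n = desc E N $ n * desc E N $ m"
  using arg_cong[OF desc_commute_xy[of N], of "\<lambda>A. A $ m $ n"]
  by (simp only: xser_mult_yser_nth yser_mult_xser_nth)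

lemma asc_commute: "asc E N $ m * asc E N $ n = asc E N $ n * asc E N $ m"
  using arg_cong[OF asc_commute_xy[of N], of "\<lambda>A. A $ m $ n"]
  by (simp only: xser_mult_yser_nth yser_mult_xser_nth)

end

end


section \<open>A ring of operators\<close>

text \<open>
  The additive maps of \<open>'v\<close> form a ring, which is the zero ring when \<open>'v\<close> is trivial, whereas the
  class \<^class>\<open>ring_1\<close> demands \<open>0 \<noteq> 1\<close>. The direct product with the rationals is a nonzero ring
  for every \<open>'v\<close>, and factorials are invertible in it as soon as they act invertibly on \<open>'v\<close>. The
  operators under study live in the first component.
\<close>

typedef (overloaded) 'v endo =
  "{f :: 'v::ab_group_add \<Rightarrow> 'v. \<forall>u v. f (u + v) = f u + f v} \<times> (UNIV :: rat set)"
  by (rule exI[of _ "(id, 0)"]) simp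

setup_lifting type_definition_endo

lift_definition endo_apply :: "'v::ab_group_add endo \<Rightarrow> 'v \<Rightarrow> 'v" is fst .

lift_definition endo_rat :: "'v::ab_group_add endo \<Rightarrow> rat" is snd .

lemma endo_eqI: "\<lbrakk>\<And>v. endo_apply A v = endo_apply B v; endo_rat A = endo_rat B\<rbrakk> \<Longrightarrow> A = B"
  by transfer (auto simp: prod_eq_iff)

text \<open>
  A map that is not additive is sent to zero, to make this a total function.
\<close>

lift_definition endo_of :: "('v \<Rightarrow> 'v) \<Rightarrow> rat \<Rightarrow> 'v::ab_group_add endo" is
  "\<lambda>f c. (if \<forall>u v. f (u + v) = f u + f v then f else (\<lambda>_. 0), c)"
  by auto

lemma endo_apply_of: "(\<And>u v. f (u + v) = f u + f v) \<Longrightarrow> endo_apply (endo_of f c) = f"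
  by transfer auto

lemma endo_rat_of: "endo_rat (endo_of f c) = c"
  by transfer simp

lemma endo_apply_add: "endo_apply A (u + v) = endo_apply A u + endo_apply A v"
  by transfer auto

lemma endo_apply_0: "endo_apply A 0 = 0"
  using endo_apply_add[of A 0 0] by simp

instantiation endo :: (ab_group_add) ring_1
begin

lift_definition zero_endo :: "'a endo" is "(\<lambda>_. 0, 0)" by simp
lift_definition one_endo :: "'a endo" is "(\<lambda>v. v, 1)" by simp
lift_definition plus_endo :: "'a endo \<Rightarrow> 'a endo \<Rightarrow> 'a endo"
  is "\<lambda>A B. (\<lambda>v. fst A v + fst B v, snd A + snd B)"
  by (auto simp: algebra_simps)
lift_definition minus_endo :: "'a endo \<Rightarrow> 'a endo \<Rightarrow> 'a endo"
  is "\<lambda>A B. (\<lambda>v. fst A v - fst B v, snd A - snd B)"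
  by (auto simp: algebra_simps)
lift_definition uminus_endo :: "'a endo \<Rightarrow> 'a endo"
  is "\<lambda>A. (\<lambda>v. - fst A v, - snd A)"
  by auto
lift_definition times_endo :: "'a endo \<Rightarrow> 'a endo \<Rightarrow> 'a endo"
  is "\<lambda>A B. (\<lambda>v. fst A (fst B v), snd A * snd B)"
  by auto

instance
  by standard (transfer; auto simp: algebra_simps; fail)+

end

lemma endo_apply_simps [simp]:
  "endo_apply 0 v = 0" "endo_apply 1 v = v"
  "endo_apply (A + B) v = endo_apply A v + endo_apply B v"
  "endo_apply (A - B) v = endo_apply A v - endo_apply B v"
  "endo_apply (A * B) v = endo_apply A (endo_apply B v)"
  by (transfer; simp)+

lemma endo_rat_simps [simp]:
  "endo_rat 0 = 0" "endo_rat 1 = 1" "endo_rat (A + B) = endo_rat A + endo_rat B"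
  "endo_rat (A - B) = endo_rat A - endo_rat B" "endo_rat (A * B) = endo_rat A * endo_rat B"
  by (transfer; simp)+

lemma endo_apply_sum: "endo_apply (sum f I) v = (\<Sum>i\<in>I. endo_apply (f i) v)"
  by (induction I rule: infinite_finite_induct) simp_all

lemma endo_apply_power: "endo_apply (A ^ n) v = (endo_apply A ^^ n) v"
  by (induction n) simp_all

definition opser_of :: "'v::ab_group_add endo fps \<Rightarrow> 'v opser" where
  "opser_of F = (\<lambda>n. endo_apply (F $ n))"

lemma opser_of_1: "opser_of 1 = op_one"
  by (auto simp: opser_of_def op_one_def fun_eq_iff)

lemma opser_of_mult: "opser_of (F * G) = op_mult (opser_of F) (opser_of G)"
  by (simp add: opser_of_def op_mult_def fun_eq_iff fps_mult_nth endo_apply_sum atLeast0AtMost)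

lemma opser_of_prod_list: "opser_of (prod_list Fs) = op_prod (map opser_of Fs)"
  by (induction Fs) (simp_all add: op_prod_def opser_of_1 opser_of_mult)


section \<open>Commutativity in the Fock space\<close>

context charged_boson_fock
begin

definition invfact :: "nat \<Rightarrow> 'v endo" where
  "invfact n = endo_of (scale (1 / fact n)) (1 / fact n)"

lemma endo_apply_of_nat: "endo_apply (of_nat n) v = scale (of_nat n) v"
  by (induction n) (simp_all add: scale_left_distrib)

lemma endo_rat_of_nat: "endo_rat (of_nat n :: 'v endo) = of_nat n"
  by (induction n) simp_all

sublocale invertible_factorials invfact
proof
  fix n
  show "of_nat (fact n) * invfact n = 1"
    by (rule endo_eqI)
      (simp_all add: invfact_def endo_apply_of scale_right_distrib endo_apply_of_nat endo_rat_of
        endo_rat_of_nat)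
qed

lemma opser_of_exps: "opser_of (exps A) = op_exp scale (endo_apply A)"
  by (simp add: opser_of_def exps_def op_exp_def fun_eq_iff invfact_def endo_apply_of
      scale_right_distrib endo_apply_power)

text \<open>
  The operator \<open>\<phi>\<^sub>-\<^sub>a \<phi>\<^sup>*\<^sub>b\<close>. The rational component is \<open>0\<close>, which is consistent with
  the commutation relations because their right-hand sides contain no constants.
\<close>

definition hop :: "int \<Rightarrow> int \<Rightarrow> 'v endo" where
  "hop a b = endo_of (phi (- a) \<circ> phis b) 0"

lemma endo_apply_hop: "endo_apply (hop a b) = phi (- a) \<circ> phis b"
  unfolding hop_def by (rule endo_apply_of) (simp add: phi_add phis_add)

lemma phi_diff: "phi i (u - v) = phi i u - phi i v"
  using phi_add[of i "u - v" v] by simp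

text \<open>
  Since \<open>\<phi>\<^sub>-\<^sub>a\<close> and \<open>\<phi>\<^sup>*\<^sub>b\<close> have a scalar commutator, nonzero only for \<open>a = b\<close>, the
  quadratic operators close under commutators; with \<open>- hop a b\<close> in place of the matrix unit
  \<open>e\<^sub>a\<^sub>b\<close> these are the relations of the Lie algebra of infinite matrices.
\<close>

lemma hop_commutator:
  "hop a b * hop c d - hop c d * hop a b = (if a = d then hop c b else 0) - (if b = c then hop a d else 0)"
proof (rule endo_eqI)
  fix v
  have swap: "phis j (phi i u) = phi i (phis j u) - (if i = - j then u else 0)" for i j u
    by (simp add: phi_phis)
  show "endo_apply (hop a b * hop c d - hop c d * hop a b) v =
    endo_apply ((if a = d then hop c b else 0) - (if b = c then hop a d else 0)) v"
    by (simp add: endo_apply_hop swap phi_diff phi_0 comm_phi_phi[of "- a" "- c"] comm_phis_phis[of b d])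
qed (simp add: hop_def endo_rat_of)

lemma hop_commute: "\<lbrakk>a \<noteq> d; b \<noteq> c\<rbrakk> \<Longrightarrow> hop a b * hop c d = hop c d * hop a b"
  using hop_commutator[of a b c d] by simp

lemma Bstar_partial_eq:
  "Bstar_partial scale phi phis M N = opser_of (desc (\<lambda>k. hop (M - int k) (M - int k - 1)) N)"
  unfolding Bstar_partial_def desc_def opser_of_prod_list map_map Let_def
  by (intro arg_cong[of _ _ op_prod] map_cong refl)
    (simp only: comp_apply opser_of_exps endo_apply_hop)

lemma Bstar_partial_0: "Bstar_partial scale phi phis M N n 0 = 0"
  by (simp add: Bstar_partial_eq opser_of_def endo_apply_0)

lemma Bstar_partial_commute:
  "Bstar_partial scale phi phis M N m (Bstar_partial scale phi phis M N n v) =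
   Bstar_partial scale phi phis M N n (Bstar_partial scale phi phis M N m v)"
proof -
  let ?P = "desc (\<lambda>k. hop (M - int k) (M - int k - 1)) N"
  have "?P $ m * ?P $ n = ?P $ n * ?P $ m"
    by (rule desc_commute) (simp_all add: hop_commutator hop_commute)
  from arg_cong[OF this, of "\<lambda>A. endo_apply A v"] show ?thesis
    by (simp add: Bstar_partial_eq opser_of_def)
qed

lemma Cstar_partial_eq:
  "Cstar_partial scale phi phis M N = opser_of (asc (\<lambda>k. hop (M - int k - 1) (M - int k)) N)"
  unfolding Cstar_partial_def asc_def opser_of_prod_list map_map Let_def
  by (intro arg_cong[of _ _ op_prod] map_cong refl)
    (simp only: comp_apply opser_of_exps endo_apply_hop minus_diff_eq, simp add: algebra_simps)

lemma Cstar_partial_0: "Cstar_partial scale phi phis M N n 0 = 0"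
  by (simp add: Cstar_partial_eq opser_of_def endo_apply_0)

lemma Cstar_partial_commute:
  "Cstar_partial scale phi phis M N m (Cstar_partial scale phi phis M N n v) =
   Cstar_partial scale phi phis M N n (Cstar_partial scale phi phis M N m v)"
proof -
  let ?P = "asc (\<lambda>k. hop (M - int k - 1) (M - int k)) N"
  have "?P $ m * ?P $ n = ?P $ n * ?P $ m"
    by (rule asc_commute) (simp_all add: hop_commutator hop_commute)
  from arg_cong[OF this, of "\<lambda>A. endo_apply A v"] show ?thesis
    by (simp add: Cstar_partial_eq opser_of_def)
qed

end

text \<open>
  One \<open>N\<close> beyond the stability bounds of the three vectors \<open>v\<close>, \<open>F m v\<close> and \<open>F n v\<close> lets both
  compositions be computed with \<open>P N\<close>.
\<close>

lemma stable_limit_commute: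
  fixes P :: "nat \<Rightarrow> 'v opser"
  assumes stable: "\<And>v. \<exists>N0. \<forall>N\<ge>N0. \<forall>n. P N n v = F n v"
    and comm: "\<And>N m n v. P N m (P N n v) = P N n (P N m v)"
  shows "F m (F n v) = F n (F m v)"
proof -
  obtain K0 where K0: "\<And>N k. K0 \<le> N \<Longrightarrow> P N k v = F k v"
    using stable[of v] by auto
  obtain K1 where K1: "\<And>N k. K1 \<le> N \<Longrightarrow> P N k (F m v) = F k (F m v)"
    using stable[of "F m v"] by auto
  obtain K2 where K2: "\<And>N k. K2 \<le> N \<Longrightarrow> P N k (F n v) = F k (F n v)"
    using stable[of "F n v"] by auto
  define N where "N = max K0 (max K1 K2)"
  have "K0 \<le> N" "K1 \<le> N" "K2 \<le> N" by (simp_all add: N_def)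
  then show ?thesis using comm[of N m n v] by (simp add: K0 K1 K2)
qed

lemma op_mult2_in_x_in_y:
  assumes "\<And>n. F n 0 = 0"
  shows "op_mult2 (in_x F) (in_y G) m n v = F m (G n v)"
proof -
  have "op_mult2 (in_x F) (in_y G) m n v =
    (\<Sum>i\<le>m. \<Sum>j\<le>n. if j = 0 then (if i = m then F m (G n v) else 0) else 0)"
    unfolding op_mult2_def by (intro sum.cong refl) (auto simp: in_x_def in_y_def assms)
  then show ?thesis by simp
qed

lemma op_mult2_in_y_in_x:
  assumes "\<And>n. F n 0 = 0"
  shows "op_mult2 (in_y F) (in_x G) m n v = F n (G m v)"
proof -
  have "op_mult2 (in_y F) (in_x G) m n v =
    (\<Sum>i\<le>m. \<Sum>j\<le>n. if j = n then (if i = 0 then F n (G m v) else 0) else 0)"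
    unfolding op_mult2_def by (intro sum.cong refl) (auto simp: in_x_def in_y_def assms)
  then show ?thesis by simp
qed

lemma op_mult2_commute:
  assumes "\<And>n. F n 0 = 0" and "\<And>m n v. F m (F n v) = F n (F m v)"
  shows "op_mult2 (in_x F) (in_y F) = op_mult2 (in_y F) (in_x F)"
  by (intro ext) (simp add: op_mult2_in_x_in_y op_mult2_in_y_in_x assms)

theorem proposition3p2:
  fixes scale :: "'k::field_char_0 \<Rightarrow> 'v::ab_group_add \<Rightarrow> 'v"
    and phi phis :: "int \<Rightarrow> 'v \<Rightarrow> 'v" and vac :: 'v and M :: int
  assumes "charged_boson_fock scale phi phis vac"
    and "M > 0"
  shows "op_mult2 (in_x (Bstar scale phi phis M)) (in_y (Bstar scale phi phis M)) =
         op_mult2 (in_y (Bstar scale phi phis M)) (in_x (Bstar scale phi phis M)) \<and>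
         op_mult2 (in_x (Cstar scale phi phis M)) (in_y (Cstar scale phi phis M)) =
         op_mult2 (in_y (Cstar scale phi phis M)) (in_x (Cstar scale phi phis M))"
proof -
  interpret charged_boson_fock scale phi phis vac by (rule assms(1))
  have "Bstar scale phi phis M n 0 = 0" for n
    using Bstar_stable[of M 0] Bstar_partial_0 by (metis order_refl)
  moreover have "Cstar scale phi phis M n 0 = 0" for n
    using Cstar_stable[of M 0] Cstar_partial_0 by (metis order_refl)
  ultimately show ?thesis
    by (intro conjI op_mult2_commute stable_limit_commute[OF Bstar_stable Bstar_partial_commute]
        stable_limit_commute[OF Cstar_stable Cstar_partial_commute])
qed

end
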